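(* Fix $k\ge 1$, server weights $0< w_1\le \dots\le w_k$, and a finite uniform metric space $U$. If there exists an $\alpha_1$-competitive (possibly randomized) online algorithm for Weighted $k$-Server -- Service Pattern Construction (W$k$S-SPC) and there exists an $\alpha_2$-competitive (possibly randomized) online algorithm for Weighted $k$-Server -- Revealed Service Pattern (W$k$S-RSP), then there exists an $(\alpha_1\alpha_2)$-competitive online algorithm for the weighted $k$-server problem on the uniform metric space $U$.
   Context: Uniform metric: a set $U$ of points, every two distinct points at distance $1$. Weighted $k$-server: there are $k$ servers located at points of $U$, server $i$ has weight $w_i$. Requests $\sigma_1,\sigma_2,\ldots\in U$ arrive online; after request $\sigma_t$ arrives, the algorithm moves servers so that some server is at $\sigma_t$. The cost is $\sum_i w_i\cdot(\text{number of moves of server } i)$. An (online, possibly randomized) algorithm is $\alpha$-competitive if on every request sequence its (expected) cost is at most $\alpha$ times the cost of an optimal (offline) solution (up to an additive constant independent of the input). A (hierarchical) service pattern over $[1,T+1)$ is a $k$-tuple $\mathcal I=(\mathcal I^1,\dots,\mathcal I^k)$ where each level $\mathcal I^\ell$ is a partition of $[1,T+1)$ into left-closed right-open intervals with integer endpoints, and $\mathcal I^\ell$ refines $\mathcal I^{\ell+1}$ for each $\ell<k$. Its cost is $\sum_\ell w_\ell|\mathcal I^\ell|$. A labeling is a function from the multiset $\mathcal I^1\uplus\dots\uplus\mathcal I^k$ to $U$; it is feasible with respect to a request sequence $(\sigma_1,\dots,\sigma_T)$ if for each $t$ some interval containing $t$ is labeled $\sigma_t$; a service pattern is feasible if it has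 a feasible labeling. For a service pattern $\mathcal I_{t-1}$ over $[1,t)$ with last intervals $L^i_{t-1}\in\mathcal I^i_{t-1}$, and $\ell\in\{0,\dots,k\}$, the $\ell$-extension $\mathcal I_t$ over $[1,t+1)$ is obtained by adding the interval $[t,t+1)$ as a new interval to levels $i\le \ell$, and replacing $L^i_{t-1}$ by $L^i_{t-1}\cup[t,t+1)$ in levels $i>\ell$ (for $t=1$ all levels consist of $[1,2)$). W$k$S-SPC: requests $\sigma_t\in U$ arrive online; in response to $\sigma_t$ the algorithm outputs $\ell_t\in\{0,\dots,k\}$, such that the $\ell_t$-extension $\mathcal I_t$ of its previous pattern $\mathcal I_{t-1}$ is feasible with respect to $(\sigma_1,\dots,\sigma_t)$. It is $\alpha$-competitive if the (expected) cost of its final service pattern is at most $\alpha$ times the optimal cost of the weighted $k$-server instance. W$k$S-RSP: in round $t$ the algorithm receives $(\sigma_t,\ell_t)$, where it is guaranteed that the $\ell_t$-extension $\mathcal I_t$ of the previously revealed pattern $\mathcal I_{t-1}$ is feasible with respect to $(\sigma_1,\dots,\sigma_t)$; the algorithm must move its servers so that $\sigma_t$ is covered. It is $\beta$-competitive if its (expected) cost is at most $\beta$ times the cost of the final revealed service pattern. *)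

theory Defs
  imports "HOL-Probability.Probability"
begin

text \<open>
  Conventions.  The uniform metric space is the set of all elements of a type \<open>'u\<close> of class
  \<open>finite\<close>.  Servers, levels and rounds are numbered from 1, so the request of round \<open>t\<close> is
  \<open>\<sigma> ! (t - 1)\<close>.  A configuration maps a server in \<open>{1..k}\<close> to its location; its values
  outside \<open>{1..k}\<close> are irrelevant.
\<close>

section \<open>Weighted k-server on a uniform metric\<close>

definition move_cost :: "nat \<Rightarrow> (nat \<Rightarrow> real) \<Rightarrow> nat \<Rightarrow> (nat \<Rightarrow> nat \<Rightarrow> 'u) \<Rightarrow> real" where
  "move_cost k w T c = (\<Sum>i=1..k. w i * real (card {t \<in> {1..T}. c t i \<noteq> c (t - 1) i}))"

definition covers :: "nat \<Rightarrow> 'u list \<Rightarrow> (nat \<Rightarrow> nat \<Rightarrow> 'u) \<Rightarrow> bool" where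
  "covers k \<sigma> c \<longleftrightarrow> (\<forall>t\<in>{1..length \<sigma>}. \<exists>i\<in>{1..k}. c t i = \<sigma> ! (t - 1))"

text \<open>The optimal offline cost when the servers start in the configuration \<open>s0\<close>.\<close>

definition opt_cost :: "nat \<Rightarrow> (nat \<Rightarrow> real) \<Rightarrow> (nat \<Rightarrow> 'u) \<Rightarrow> 'u list \<Rightarrow> real" where
  "opt_cost k w s0 \<sigma> = Inf {move_cost k w (length \<sigma>) c | c. c 0 = s0 \<and> covers k \<sigma> c}"

section \<open>Service patterns\<close>

text \<open>
  An interval with integer endpoints is represented by the set \<open>{a..<b}\<close> of the integers in it, and
  a \<open>k\<close>-tuple of levels by a function on \<open>{1..k}\<close>.
\<close>

type_synonym pattern = "nat \<Rightarrow> nat set set"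

definition service_pattern :: "nat \<Rightarrow> nat \<Rightarrow> pattern \<Rightarrow> bool" where
  "service_pattern k T I \<longleftrightarrow>
     (\<forall>l\<in>{1..k}. partition_on {1..<T+1} (I l) \<and> (\<forall>J\<in>I l. \<exists>a b. J = {a..<b})) \<and>
     (\<forall>l\<in>{1..<k}. refines {1..<T+1} (I l) (I (l + 1)))"

definition pattern_cost :: "nat \<Rightarrow> (nat \<Rightarrow> real) \<Rightarrow> pattern \<Rightarrow> real" where
  "pattern_cost k w I = (\<Sum>l=1..k. w l * real (card (I l)))"

text \<open>
  The level is an argument of the labeling because the same interval may occur, with different
  labels, in several levels.
\<close>

definition feasible_labeling :: "nat \<Rightarrow> 'u list \<Rightarrow> pattern \<Rightarrow> (nat \<Rightarrow> nat set \<Rightarrow> 'u) \<Rightarrow> bool" where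
  "feasible_labeling k \<sigma> I lab \<longleftrightarrow>
     (\<forall>t\<in>{1..length \<sigma>}. \<exists>l\<in>{1..k}. \<exists>J\<in>I l. t \<in> J \<and> lab l J = \<sigma> ! (t - 1))"

definition feasible_pattern :: "nat \<Rightarrow> 'u list \<Rightarrow> pattern \<Rightarrow> bool" where
  "feasible_pattern k \<sigma> I \<longleftrightarrow>
     service_pattern k (length \<sigma>) I \<and> (\<exists>lab. feasible_labeling k \<sigma> I lab)"

definition last_interval :: "nat \<Rightarrow> nat set set \<Rightarrow> nat set" where
  "last_interval T P = (THE J. J \<in> P \<and> T \<in> J)"

text \<open>The \<open>l\<close>-extension, over \<open>[1, t + 1)\<close>, of a service pattern \<open>I\<close> over \<open>[1, t)\<close>.\<close>

definition extension :: "nat \<Rightarrow> nat \<Rightarrow> pattern \<Rightarrow> pattern" where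
  "extension t l I = (\<lambda>i.
     if t = 1 then {{1..<2}}
     else if i \<le> l then I i \<union> {{t..<t+1}}
     else (I i - {last_interval (t - 1) (I i)}) \<union> {last_interval (t - 1) (I i) \<union> {t..<t+1}})"

text \<open>The pattern after the first \<open>t\<close> extensions by the levels in \<open>ls\<close>.\<close>

primrec extensions :: "nat list \<Rightarrow> nat \<Rightarrow> pattern" where
  "extensions ls 0 = (\<lambda>_. {})"
| "extensions ls (Suc t) = extension (Suc t) (ls ! t) (extensions ls t)"

definition feasible_levels :: "nat \<Rightarrow> 'u list \<Rightarrow> nat list \<Rightarrow> bool" where
  "feasible_levels k \<sigma> ls \<longleftrightarrow> length ls = length \<sigma> \<and>
     (\<forall>t\<in>{1..length \<sigma>}. ls ! (t - 1) \<in> {0..k} \<and> feasible_pattern k (take t \<sigma>) (extensions ls t))"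

section \<open>Online algorithms and competitiveness\<close>

text \<open>
  A deterministic online algorithm maps the input received so far to its current decision: a
  configuration, or a level.  A randomized online algorithm is a probability distribution \<open>M\<close> over
  deterministic ones for which every decision is a random variable.  Competitiveness is against
  every fixed input sequence, up to an additive constant that does not depend on that sequence.
\<close>

definition run :: "(nat \<Rightarrow> 'u) \<Rightarrow> ('r list \<Rightarrow> nat \<Rightarrow> 'u) \<Rightarrow> 'r list \<Rightarrow> nat \<Rightarrow> nat \<Rightarrow> 'u" where
  "run s0 A \<rho> t = (if t = 0 then s0 else A (take t \<rho>))"

definition randomized_server_alg :: "nat \<Rightarrow> ('r list \<Rightarrow> nat \<Rightarrow> 'u) measure \<Rightarrow> bool" where
  "randomized_server_alg k M \<longleftrightarrow> prob_space M \<and>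
     (\<forall>h. \<forall>i\<in>{1..k}. (\<lambda>A. A h i) \<in> M \<rightarrow>\<^sub>M count_space UNIV)"

definition wks_competitive ::
  "nat \<Rightarrow> (nat \<Rightarrow> real) \<Rightarrow> (nat \<Rightarrow> 'u) \<Rightarrow> real \<Rightarrow> ('u list \<Rightarrow> nat \<Rightarrow> 'u) measure \<Rightarrow> bool" where
  "wks_competitive k w s0 \<alpha> M \<longleftrightarrow> randomized_server_alg k M \<and>
     (\<forall>A\<in>space M. \<forall>\<sigma>. covers k \<sigma> (run s0 A \<sigma>)) \<and>
     (\<exists>c. \<forall>\<sigma>. (\<integral>A. move_cost k w (length \<sigma>) (run s0 A \<sigma>) \<partial>M) \<le> \<alpha> * opt_cost k w s0 \<sigma> + c)"

definition spc_levels :: "('u list \<Rightarrow> nat) \<Rightarrow> 'u list \<Rightarrow> nat list" where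
  "spc_levels A \<sigma> = map (\<lambda>t. A (take t \<sigma>)) [1..<length \<sigma> + 1]"

definition spc_competitive ::
  "nat \<Rightarrow> (nat \<Rightarrow> real) \<Rightarrow> (nat \<Rightarrow> 'u) \<Rightarrow> real \<Rightarrow> ('u list \<Rightarrow> nat) measure \<Rightarrow> bool" where
  "spc_competitive k w s0 \<alpha> M \<longleftrightarrow> prob_space M \<and>
     (\<forall>h. (\<lambda>A. A h) \<in> M \<rightarrow>\<^sub>M count_space UNIV) \<and>
     (\<forall>A\<in>space M. \<forall>\<sigma>. feasible_levels k \<sigma> (spc_levels A \<sigma>)) \<and>
     (\<exists>c. \<forall>\<sigma>. (\<integral>A. pattern_cost k w (extensions (spc_levels A \<sigma>) (length \<sigma>)) \<partial>M)
                \<le> \<alpha> * opt_cost k w s0 \<sigma> + c)"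

definition rsp_input :: "nat \<Rightarrow> ('u \<times> nat) list \<Rightarrow> bool" where
  "rsp_input k \<rho> \<longleftrightarrow> feasible_levels k (map fst \<rho>) (map snd \<rho>)"

definition rsp_competitive ::
  "nat \<Rightarrow> (nat \<Rightarrow> real) \<Rightarrow> (nat \<Rightarrow> 'u) \<Rightarrow> real \<Rightarrow> (('u \<times> nat) list \<Rightarrow> nat \<Rightarrow> 'u) measure \<Rightarrow> bool" where
  "rsp_competitive k w s0 \<beta> M \<longleftrightarrow> randomized_server_alg k M \<and>
     (\<forall>A\<in>space M. \<forall>\<rho>. rsp_input k \<rho> \<longrightarrow> covers k (map fst \<rho>) (run s0 A \<rho>)) \<and>
     (\<exists>c. \<forall>\<rho>. rsp_input k \<rho> \<longrightarrow>
        (\<integral>A. move_cost k w (length \<rho>) (run s0 A \<rho>) \<partial>M)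
          \<le> \<beta> * pattern_cost k w (extensions (map snd \<rho>) (length \<rho>)) + c)"

end

theory Submission
  imports Defs
begin

text \<open>
  Feed the levels chosen by the service pattern construction algorithm, together with the requests,
  into the revealed service pattern algorithm, the two drawing their random bits independently. By
  Fubini the expected cost is at most \<open>\<alpha>\<^sub>2\<close> times the expected cost of the constructed pattern plus a
  constant, and the latter is at most \<open>\<alpha>\<^sub>1\<close> times the optimum plus a constant. Chaining the two
  bounds needs \<open>\<alpha>\<^sub>2 \<ge> 0\<close>, which holds because feasible patterns can be arbitrarily expensive while
  movement costs are nonnegative.
\<close>

section \<open>Measurability\<close>

text \<open>Lists over a countable type are countable, so it suffices to treat each fixed head value
  and glue along the random head.\<close>

lemma measurable_map_list_count_space:
  fixes f :: "'t \<Rightarrow> 'a \<Rightarrow> 'b::countable"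
  assumes "\<And>t. t \<in> set ts \<Longrightarrow> f t \<in> M \<rightarrow>\<^sub>M count_space UNIV"
  shows "(\<lambda>x. map (\<lambda>t. f t x) ts) \<in> M \<rightarrow>\<^sub>M count_space UNIV"
  using assms
proof (induction ts)
  case Nil
  then show ?case by simp
next
  case (Cons t ts)
  have tl: "(\<lambda>x. map (\<lambda>t. f t x) ts) \<in> M \<rightarrow>\<^sub>M count_space UNIV"
    using Cons by simp
  have "(\<lambda>x. b # map (\<lambda>t. f t x) ts) \<in> M \<rightarrow>\<^sub>M count_space UNIV" for b
    by (rule measurable_compose[OF tl]) simp
  then have "(\<lambda>x. f t x # map (\<lambda>t. f t x) ts) \<in> M \<rightarrow>\<^sub>M count_space UNIV"
    by (rule measurable_compose_countable) (use Cons in simp)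
  then show ?case by simp
qed

lemma pred_eq_count_space:
  fixes f g :: "'a \<Rightarrow> 'b::countable"
  assumes "f \<in> M \<rightarrow>\<^sub>M count_space UNIV" and "g \<in> M \<rightarrow>\<^sub>M count_space UNIV"
  shows "Measurable.pred M (\<lambda>x. f x = g x)"
proof -
  have "Measurable.pred M (\<lambda>x. f x = b)" for b
    by (rule measurable_compose[OF assms(1)]) simp
  then show ?thesis
    by (rule measurable_compose_countable) (rule assms(2))
qed

lemma move_cost_measurable:
  fixes B :: "'a \<Rightarrow> 'r list \<Rightarrow> nat \<Rightarrow> 'u::countable"
  assumes meas: "\<And>h i. i \<in> {1..k} \<Longrightarrow> (\<lambda>x. B x h i) \<in> M \<rightarrow>\<^sub>M count_space UNIV"
  shows "(\<lambda>x. move_cost k w T (run s0 (B x) \<rho>)) \<in> borel_measurable M"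
proof -
  have run: "(\<lambda>x. run s0 (B x) \<rho> t i) \<in> M \<rightarrow>\<^sub>M count_space UNIV" if "i \<in> {1..k}" for t i
    using meas[OF that] by (cases "t = 0") (simp_all add: run_def)
  have pred: "Measurable.pred M (\<lambda>x. run s0 (B x) \<rho> t i = run s0 (B x) \<rho> (t - 1) i)"
    if "i \<in> {1..k}" for t i
    by (rule pred_eq_count_space; rule run[OF that])
  \<comment> \<open>Written as a sum of indicators, one for each round, the number of moves is
    measurable term by term.\<close>
  have "(\<lambda>x. move_cost k w T (run s0 (B x) \<rho>)) =
    (\<lambda>x. \<Sum>i=1..k. w i * (\<Sum>t\<in>{1..T}.
       if run s0 (B x) \<rho> t i = run s0 (B x) \<rho> (t - 1) i then 0 else 1))"
    unfolding move_cost_def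
    by (intro ext sum.cong arg_cong2[where f = "(*)"] refl)
      (auto simp: sum.If_cases intro!: arg_cong[where f = card])
  also have "\<dots> \<in> borel_measurable M"
    by (intro borel_measurable_sum borel_measurable_times borel_measurable_const
        measurable_If pred[unfolded pred_def] measurable_const) auto
  finally show ?thesis .
qed

text \<open>Each server moves at most once per round. The bound is uniform in the run and so yields
  integrability of the cost.\<close>

lemma abs_move_cost_le: "\<bar>move_cost k w T c\<bar> \<le> (\<Sum>i=1..k. \<bar>w i\<bar> * real T)"
proof -
  have "card {t \<in> {1..T}. c t i \<noteq> c (t - 1) i} \<le> T" for i
    by (rule order_trans[OF card_mono[of "{1..T}"]]) auto
  then show ?thesis
    unfolding move_cost_def
    by (intro order_trans[OF sum_abs] sum_mono) (auto simp: abs_mult intro!: mult_left_mono)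
qed

lemma move_cost_nonneg:
  assumes "\<And>i. i \<in> {1..k} \<Longrightarrow> 0 \<le> w i"
  shows "0 \<le> move_cost k w T c"
  unfolding move_cost_def using assms by (intro sum_nonneg mult_nonneg_nonneg) auto

lemma prob_space_integrable_finite_valued:
  fixes g :: "'b::countable \<Rightarrow> real"
  assumes "prob_space M" and X: "X \<in> M \<rightarrow>\<^sub>M count_space UNIV"
    and S: "finite S" "\<And>x. x \<in> space M \<Longrightarrow> X x \<in> S"
  shows "integrable M (\<lambda>x. g (X x))"
proof -
  interpret prob_space M by fact
  show ?thesis
  proof (rule integrable_const_bound)
    \<comment> \<open>A crude bound: the sum contains \<open>\<bar>g (X x)\<bar>\<close> as one of
      its nonnegative terms.\<close>
    show "AE x in M. norm (g (X x)) \<le> (\<Sum>s\<in>S. \<bar>g s\<bar>)"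
      using S by (intro AE_I2) (auto intro: member_le_sum)
    show "(\<lambda>x. g (X x)) \<in> borel_measurable M"
      by (rule measurable_compose[OF X]) simp
  qed
qed

text \<open>
  The quotient \<open>\<sigma>\<close>-algebra along \<open>f\<close> makes the image of \<open>f\<close> the whole space, so that properties of
  all values of \<open>f\<close> hold everywhere rather than almost everywhere.
\<close>

definition image_algebra :: "'a measure \<Rightarrow> ('a \<Rightarrow> 'b) \<Rightarrow> 'b measure" where
  "image_algebra M f =
     sigma (f ` space M) {B. B \<subseteq> f ` space M \<and> f -` B \<inter> space M \<in> sets M}"

lemma space_image_algebra [simp]: "space (image_algebra M f) = f ` space M"
  unfolding image_algebra_def by (rule space_measure_of) auto

lemma measurable_image_algebra: "f \<in> M \<rightarrow>\<^sub>M image_algebra M f"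
  unfolding image_algebra_def by (rule measurable_measure_of) auto

text \<open>The universal property of the quotient: maps out of it are tested after composition with
  \<open>f\<close>.\<close>

lemma measurable_from_image_algebra:
  assumes "(\<lambda>x. g (f x)) \<in> M \<rightarrow>\<^sub>M N"
  shows "g \<in> image_algebra M f \<rightarrow>\<^sub>M N"
proof (rule measurableI)
  fix y assume "y \<in> space (image_algebra M f)"
  then show "g y \<in> space N"
    using measurable_space[OF assms] by auto
next
  fix B assume "B \<in> sets N"
  have "f -` (g -` B \<inter> f ` space M) \<inter> space M = (\<lambda>x. g (f x)) -` B \<inter> space M"
    by auto
  then have "f -` (g -` B \<inter> f ` space M) \<inter> space M \<in> sets M"
    using measurable_sets[OF assms \<open>B \<in> sets N\<close>] by simp
  then have "g -` B \<inter> f ` space M \<in> sets (image_algebra M f)"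
    unfolding image_algebra_def by (intro in_measure_of) auto
  then show "g -` B \<inter> space (image_algebra M f) \<in> sets (image_algebra M f)"
    by simp
qed

section \<open>Nonnegativity of the second ratio\<close>

text \<open>Choosing level \<open>k\<close> in every round opens a new interval on all levels, so no
  interval ever grows.\<close>

lemma extensions_replicate:
  assumes "t \<le> n" and "l \<le> k"
  shows "extensions (replicate n k) t l = (\<lambda>s. {s}) ` {1..<t+1}"
  using assms
proof (induction t)
  case 0
  then show ?case by simp
next
  case (Suc t)
  have "{1..<Suc t + 1} = insert (Suc t) {1..<t+1}"
    by auto
  \<comment> \<open>Round 1 is a special case of \<open>extension\<close>: every level is set to
    \<open>{{1..<2}}\<close>, which has to be seen as a singleton block.\<close>
  moreover have "{1..<2::nat} = {1}"
    by auto
  ultimately show ?case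
    using Suc by (cases "t = 0") (auto simp: extension_def)
qed

text \<open>With a single requested point, labeling everything by \<open>u\<close> is feasible. This
  gives legal inputs of any length whose pattern cost grows linearly.\<close>

lemma rsp_input_replicate:
  fixes u :: 'u
  assumes "1 \<le> k"
  shows "rsp_input k (replicate n (u, k))"
proof -
  have "feasible_pattern k (replicate t u) (extensions (replicate n k) t)" if "t \<le> n" for t
  proof -
    let ?I = "extensions (replicate n k) t"
    have I: "?I l = (\<lambda>s. {s}) ` {1..<t+1}" if "l \<le> k" for l
      using extensions_replicate \<open>t \<le> n\<close> that by blast
    have part: "partition_on {1..<t+1} ((\<lambda>s. {s}) ` {1..<t+1})"
      by (rule partition_onI) (auto simp: disjnt_def)
    have "\<exists>a b. {s} = {a..<b}" for s :: nat
      by (rule exI[of _ s], rule exI[of _ "Suc s"]) auto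
    then have "service_pattern k t ?I"
      unfolding service_pattern_def using part by (auto simp: I refines_def)
    moreover have "feasible_labeling k (replicate t u) ?I (\<lambda>_ _. u)"
      unfolding feasible_labeling_def using assms by (auto simp: I intro!: bexI[of _ 1])
    ultimately show ?thesis
      unfolding feasible_pattern_def by auto
  qed
  then show ?thesis
    unfolding rsp_input_def feasible_levels_def by (auto simp: min_def)
qed

lemma pattern_cost_replicate:
  "pattern_cost k w (extensions (replicate n k) n) = (\<Sum>l=1..k. w l) * real n"
proof -
  have "card (extensions (replicate n k) n l) = n" if "l \<in> {1..k}" for l
    using that by (subst extensions_replicate) (auto simp: card_image)
  then show ?thesis
    unfolding pattern_cost_def by (simp add: sum_distrib_right)
qed

lemma rsp_competitive_ratio_nonneg:
  fixes s0 :: "nat \<Rightarrow> 'u"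
  assumes k: "1 \<le> k" and w: "\<And>i. i \<in> {1..k} \<Longrightarrow> 0 < w i"
    and rsp: "rsp_competitive k w s0 \<beta> M"
  shows "0 \<le> \<beta>"
proof (rule ccontr)
  assume "\<not> 0 \<le> \<beta>"
  obtain c where c: "\<And>\<rho>. rsp_input k \<rho> \<Longrightarrow>
      (\<integral>A. move_cost k w (length \<rho>) (run s0 A \<rho>) \<partial>M)
        \<le> \<beta> * pattern_cost k w (extensions (map snd \<rho>) (length \<rho>)) + c"
    using rsp unfolding rsp_competitive_def by blast
  define W where "W = (\<Sum>l=1..k. w l)"
  have "0 < W"
    unfolding W_def using k w by (intro sum_pos) auto
  have "0 \<le> \<beta> * (W * real n) + c" for n
  proof -
    let ?\<rho> = "replicate n (s0 0, k)"
    have "0 \<le> (\<integral>A. move_cost k w (length ?\<rho>) (run s0 A ?\<rho>) \<partial>M)"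
      using w by (intro Bochner_Integration.integral_nonneg move_cost_nonneg) (auto intro: less_imp_le)
    also have "\<dots> \<le> \<beta> * (W * real n) + c"
      using c[OF rsp_input_replicate[OF k]] by (simp add: pattern_cost_replicate W_def)
    finally show ?thesis .
  qed
  moreover have "0 < - \<beta> * W"
    using \<open>0 < W\<close> \<open>\<not> 0 \<le> \<beta>\<close> by (simp add: mult_neg_pos)
  \<comment> \<open>For this many repetitions a negative ratio would force a negative expected
    movement cost.\<close>
  then obtain n where "c < real n * (- \<beta> * W)"
    using reals_Archimedean3 by blast
  ultimately show False
    by (smt (verit) mult.commute mult.left_commute mult_minus_left)
qed

section \<open>Composition\<close>

text \<open>The pair is the joint random seed. All levels are recomputed from the current request
  prefix, so no state needs to be stored.\<close>

definition compose_alg ::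
  "('u list \<Rightarrow> nat) \<times> (('u \<times> nat) list \<Rightarrow> nat \<Rightarrow> 'u) \<Rightarrow> 'u list \<Rightarrow> nat \<Rightarrow> 'u" where
  "compose_alg p \<sigma> = snd p (zip \<sigma> (spc_levels (fst p) \<sigma>))"

lemma length_spc_levels [simp]: "length (spc_levels A \<sigma>) = length \<sigma>"
  unfolding spc_levels_def by (simp del: upt_Suc)

text \<open>This is onlineness: earlier levels never change when requests are appended. Hence the
  composed run is one single run of the second algorithm.\<close>

lemma take_spc_levels: "take t (spc_levels A \<sigma>) = spc_levels A (take t \<sigma>)"
  unfolding spc_levels_def
  by (rule nth_equalityI) (auto simp: min_def simp del: upt_Suc split: if_splits)

lemma run_compose_alg:
  "run s0 (compose_alg p) \<sigma> = run s0 (snd p) (zip \<sigma> (spc_levels (fst p) \<sigma>))"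
  by (rule ext) (simp add: run_def compose_alg_def take_zip take_spc_levels)

lemma rsp_input_zip:
  "length ls = length \<sigma> \<Longrightarrow> rsp_input k (zip \<sigma> ls) \<longleftrightarrow> feasible_levels k \<sigma> ls"
  by (simp add: rsp_input_def)

text \<open>Only finitely many level lists are possible for a given request sequence, which makes
  the pattern cost integrable.\<close>

lemma feasible_levels_subset:
  assumes "feasible_levels k \<sigma> ls"
  shows "set ls \<subseteq> {0..k}" "length ls = length \<sigma>"
  using assms unfolding feasible_levels_def
  by (auto simp: in_set_conv_nth) (metis Suc_leI Suc_le_mono atLeastAtMost_iff diff_Suc_1 le0 One_nat_def)

lemma spc_levels_measurable:
  assumes "\<And>h. (\<lambda>A. A h) \<in> M \<rightarrow>\<^sub>M count_space UNIV"
  shows "(\<lambda>A. spc_levels A \<sigma>) \<in> M \<rightarrow>\<^sub>M count_space UNIV"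
  unfolding spc_levels_def by (rule measurable_map_list_count_space) (rule assms)

text \<open>The input of the second algorithm is itself random, but there are only countably many
  level lists; for each fixed one the decision is measurable.\<close>

lemma compose_alg_measurable:
  fixes M\<^sub>1 :: "('u list \<Rightarrow> nat) measure"
    and M\<^sub>2 :: "(('u \<times> nat) list \<Rightarrow> nat \<Rightarrow> 'u) measure"
  assumes M\<^sub>1: "\<And>h. (\<lambda>A. A h) \<in> M\<^sub>1 \<rightarrow>\<^sub>M count_space UNIV"
    and M\<^sub>2: "\<And>h. (\<lambda>A. A h i) \<in> M\<^sub>2 \<rightarrow>\<^sub>M count_space UNIV"
  shows "(\<lambda>p. compose_alg p h i) \<in> M\<^sub>1 \<Otimes>\<^sub>M M\<^sub>2 \<rightarrow>\<^sub>M count_space UNIV"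
proof -
  have "(\<lambda>p. snd p (zip h ls) i) \<in> M\<^sub>1 \<Otimes>\<^sub>M M\<^sub>2 \<rightarrow>\<^sub>M count_space UNIV" for ls
    by (rule measurable_compose[OF measurable_snd M\<^sub>2])
  moreover have "(\<lambda>p. spc_levels (fst p) h) \<in> M\<^sub>1 \<Otimes>\<^sub>M M\<^sub>2 \<rightarrow>\<^sub>M count_space UNIV"
    by (rule measurable_compose[OF measurable_fst spc_levels_measurable[OF M\<^sub>1]])
  ultimately show ?thesis
    unfolding compose_alg_def by (rule measurable_compose_countable)
qed

text \<open>The second guarantee concerns fixed inputs only. It applies because the generated input
  depends on the first seed alone, which is frozen while the second is averaged out.\<close>

lemma wks_competitive_compose:
  fixes s0 :: "nat \<Rightarrow> 'u::countable"
  assumes spc: "spc_competitive k w s0 \<alpha> M\<^sub>1" and rsp: "rsp_competitive k w s0 \<beta> M\<^sub>2"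
    and "0 \<le> \<beta>"
  defines "P \<equiv> M\<^sub>1 \<Otimes>\<^sub>M M\<^sub>2"
  shows "wks_competitive k w s0 (\<alpha> * \<beta>) (distr P (image_algebra P compose_alg) compose_alg)"
    (is "wks_competitive _ _ _ _ (distr P ?N _)")
proof -
  from spc obtain c\<^sub>1 where "prob_space M\<^sub>1"
    and M\<^sub>1: "\<And>h. (\<lambda>A. A h) \<in> M\<^sub>1 \<rightarrow>\<^sub>M count_space UNIV"
    and feas: "\<And>A \<sigma>. A \<in> space M\<^sub>1 \<Longrightarrow> feasible_levels k \<sigma> (spc_levels A \<sigma>)"
    and c\<^sub>1: "\<And>\<sigma>. (\<integral>A. pattern_cost k w (extensions (spc_levels A \<sigma>) (length \<sigma>)) \<partial>M\<^sub>1)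
                \<le> \<alpha> * opt_cost k w s0 \<sigma> + c\<^sub>1"
    unfolding spc_competitive_def by blast
  from rsp obtain c\<^sub>2 where "prob_space M\<^sub>2"
    and M\<^sub>2: "\<And>h i. i \<in> {1..k} \<Longrightarrow> (\<lambda>A. A h i) \<in> M\<^sub>2 \<rightarrow>\<^sub>M count_space UNIV"
    and cov: "\<And>A \<rho>. A \<in> space M\<^sub>2 \<Longrightarrow> rsp_input k \<rho> \<Longrightarrow> covers k (map fst \<rho>) (run s0 A \<rho>)"
    and c\<^sub>2: "\<And>\<rho>. rsp_input k \<rho> \<Longrightarrow> (\<integral>A. move_cost k w (length \<rho>) (run s0 A \<rho>) \<partial>M\<^sub>2)
          \<le> \<beta> * pattern_cost k w (extensions (map snd \<rho>) (length \<rho>)) + c\<^sub>2"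
    unfolding rsp_competitive_def randomized_server_alg_def by blast
  interpret M\<^sub>1: prob_space M\<^sub>1 by fact
  interpret M\<^sub>2: prob_space M\<^sub>2 by fact
  interpret P: pair_prob_space M\<^sub>1 M\<^sub>2 ..
  have input: "rsp_input k (zip \<sigma> (spc_levels A \<sigma>))" if "A \<in> space M\<^sub>1" for A \<sigma>
    using feas[OF that] by (simp add: rsp_input_zip)
  have comp: "compose_alg \<in> P \<rightarrow>\<^sub>M ?N"
    by (rule measurable_image_algebra)
  have coord: "(\<lambda>p. compose_alg p h i) \<in> P \<rightarrow>\<^sub>M count_space UNIV" if "i \<in> {1..k}" for h i
    unfolding P_def using M\<^sub>1 M\<^sub>2[OF that] by (rule compose_alg_measurable)
  have coord': "(\<lambda>A. A h i) \<in> ?N \<rightarrow>\<^sub>M count_space UNIV" if "i \<in> {1..k}" for h i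
    by (rule measurable_from_image_algebra[of "\<lambda>A. A h i"]) (rule coord[OF that])
  have "prob_space (distr P ?N compose_alg)"
    unfolding P_def by (rule P.prob_space_distr) (rule measurable_image_algebra)
  moreover have "covers k \<sigma> (run s0 A \<sigma>)" if "A \<in> compose_alg ` space P" for A \<sigma>
  proof -
    \<comment> \<open>Every point of the quotient space comes from a pair of seeds, so coverage is
      sure and not just almost sure.\<close>
    obtain A\<^sub>1 A\<^sub>2 where A: "A\<^sub>1 \<in> space M\<^sub>1" "A\<^sub>2 \<in> space M\<^sub>2" "A = compose_alg (A\<^sub>1, A\<^sub>2)"
      using \<open>A \<in> compose_alg ` space P\<close> by (auto simp: P_def space_pair_measure)
    show ?thesis
      using cov[OF A(2) input[OF A(1)], of \<sigma>] by (simp add: A(3) run_compose_alg)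
  qed
  moreover have "(\<integral>A. move_cost k w (length \<sigma>) (run s0 A \<sigma>) \<partial>distr P ?N compose_alg)
      \<le> \<alpha> * \<beta> * opt_cost k w s0 \<sigma> + (\<beta> * c\<^sub>1 + c\<^sub>2)" for \<sigma>
  proof -
    let ?cost = "\<lambda>p. move_cost k w (length \<sigma>) (run s0 (compose_alg p) \<sigma>)"
    let ?pat = "\<lambda>A. pattern_cost k w (extensions (spc_levels A \<sigma>) (length \<sigma>))"
    have int: "integrable (M\<^sub>1 \<Otimes>\<^sub>M M\<^sub>2) ?cost"
    proof (rule P.integrable_const_bound)
      show "AE p in M\<^sub>1 \<Otimes>\<^sub>M M\<^sub>2. norm (?cost p) \<le> (\<Sum>i=1..k. \<bar>w i\<bar> * real (length \<sigma>))"
        unfolding real_norm_def by (rule AE_I2) (rule abs_move_cost_le)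
      show "?cost \<in> borel_measurable (M\<^sub>1 \<Otimes>\<^sub>M M\<^sub>2)"
        using coord unfolding P_def by (rule move_cost_measurable)
    qed
    have "finite {ls. set ls \<subseteq> {0..k} \<and> length ls = length \<sigma>}"
      by (rule finite_lists_length_eq) simp
    then have pat: "integrable M\<^sub>1 ?pat"
      using feasible_levels_subset[OF feas]
      by (intro prob_space_integrable_finite_valued[OF \<open>prob_space M\<^sub>1\<close> spc_levels_measurable[OF M\<^sub>1],
            where g = "\<lambda>ls. pattern_cost k w (extensions ls (length \<sigma>))"]) auto
    have "(\<integral>A. move_cost k w (length \<sigma>) (run s0 A \<sigma>) \<partial>distr P ?N compose_alg) =
        (\<integral>p. ?cost p \<partial>P)"
      by (rule integral_distr[OF comp move_cost_measurable]) (rule coord')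
    also have "\<dots> = (\<integral>A\<^sub>1. \<integral>A\<^sub>2. ?cost (A\<^sub>1, A\<^sub>2) \<partial>M\<^sub>2 \<partial>M\<^sub>1)"
      unfolding P_def by (rule P.integral_fst'[OF int, symmetric])
    also have "\<dots> \<le> (\<integral>A\<^sub>1. \<beta> * ?pat A\<^sub>1 + c\<^sub>2 \<partial>M\<^sub>1)"
    proof (rule integral_mono)
      show "integrable M\<^sub>1 (\<lambda>A\<^sub>1. \<integral>A\<^sub>2. ?cost (A\<^sub>1, A\<^sub>2) \<partial>M\<^sub>2)"
        by (rule P.integrable_fst'[OF int])
      show "integrable M\<^sub>1 (\<lambda>A\<^sub>1. \<beta> * ?pat A\<^sub>1 + c\<^sub>2)"
        using pat by simp
      show "(\<integral>A\<^sub>2. ?cost (A\<^sub>1, A\<^sub>2) \<partial>M\<^sub>2) \<le> \<beta> * ?pat A\<^sub>1 + c\<^sub>2" if "A\<^sub>1 \<in> space M\<^sub>1" for A\<^sub>1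
        using c\<^sub>2[OF input[OF that], of \<sigma>] by (simp add: run_compose_alg)
    qed
    also have "\<dots> = \<beta> * (\<integral>A\<^sub>1. ?pat A\<^sub>1 \<partial>M\<^sub>1) + c\<^sub>2"
      using pat by (simp add: M\<^sub>1.prob_space)
    \<comment> \<open>Here the sign of \<open>\<beta>\<close> enters; the resulting additive
      constant \<open>\<beta> * c\<^sub>1 + c\<^sub>2\<close> is independent of
      \<open>\<sigma>\<close>.\<close>
    also have "\<dots> \<le> \<beta> * (\<alpha> * opt_cost k w s0 \<sigma> + c\<^sub>1) + c\<^sub>2"
      using c\<^sub>1 \<open>0 \<le> \<beta>\<close> by (intro add_right_mono mult_left_mono)
    finally show ?thesis
      by (simp add: algebra_simps)
  qed
  ultimately show ?thesis
    unfolding wks_competitive_def randomized_server_alg_def using coord'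
    by (auto intro!: exI[of _ "\<beta> * c\<^sub>1 + c\<^sub>2"])
qed

theorem theorem1:
  fixes k :: nat
    and w :: "nat \<Rightarrow> real"
    and s0 :: "nat \<Rightarrow> 'u::finite"
    and \<alpha>\<^sub>1 \<alpha>\<^sub>2 :: real
  assumes "k \<ge> 1"
    and "0 < w 1"
    and "mono_on {1..k} w"
    and "\<exists>M :: ('u list \<Rightarrow> nat) measure. spc_competitive k w s0 \<alpha>\<^sub>1 M"
    and "\<exists>M :: (('u \<times> nat) list \<Rightarrow> nat \<Rightarrow> 'u) measure. rsp_competitive k w s0 \<alpha>\<^sub>2 M"
  shows "\<exists>M :: ('u list \<Rightarrow> nat \<Rightarrow> 'u) measure. wks_competitive k w s0 (\<alpha>\<^sub>1 * \<alpha>\<^sub>2) M"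
proof -
  have "0 < w i" if "i \<in> {1..k}" for i
    using mono_onD[OF assms(3), of 1 i] that assms(1,2) by auto
  then have "0 \<le> \<alpha>\<^sub>2"
    using assms(1,5) rsp_competitive_ratio_nonneg by blast
  then show ?thesis
    using assms(4,5) wks_competitive_compose by blast
qed

end
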